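(* Let $x_0\in\mathcal{X}$, $\varepsilon>0$ and $0<\delta\le 1$. Let $u^+:[0,+\infty)\to\mathcal{U}$ be the (piecewise-constant) control law applied in a run of infinite length of the Learn-Control Algorithm (described in the context) with parameters $\varepsilon,\delta$, initial state $x_0$ and goodness function $G:\mathcal{F}\times\mathbb{R}^n\to\mathbb{R}$, and let $\phi_{u^+}(\cdot,x_0)$ be the resulting trajectory. Assume that $G$ has Lipschitz constant $L$. Then, for all $t\geq (m+1)\varepsilon$, with $x=\phi_{u^+}(t,x_0)$, $$\Big|G\big(\phi_{u^+}(\cdot,x_0)|_{[0,t]},\,v_x(u^+(t))\big)-\max_{u\in\mathcal{U}} G\big(\phi_{u^+}(\cdot,x_0)|_{[0,t]},\,v_x(u)\big)\Big| \leq 6L(M_0+1)(M_1+1)(m+1)^3\left(1+\frac{4m\sqrt{m}}{\delta}\right)\varepsilon+LM_0(m+1)\delta .$$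
   Context: System. Let $n,m\ge 1$, $\mathcal{X}\subseteq\mathbb{R}^n$, $\mathcal{U}=[-1,1]^m=\{u\in\mathbb{R}^m : \|u\|_\infty\le 1\}$. Consider the control-affine system $\dot x=f(x)+\sum_{i=1}^m g_i(x)u_i$ evolving on $\mathcal{X}$ (trajectories are assumed to stay in $\mathcal{X}$), where $f,g_1,\dots,g_m:\mathcal{X}\to\mathbb{R}^n$ are continuous and there are constants $M_0,M_1\ge 0$ such that for all $x,y\in\mathcal{X}$ and all $i$: $\|f(x)\|\le M_0$, $\|g_i(x)\|\le M_0$, $\|f(x)-f(y)\|\le M_1\|x-y\|$, $\|g_i(x)-g_i(y)\|\le M_1\|x-y\|$. Here $\|\cdot\|$ is the Euclidean norm. For a piecewise-constant control law $u$, $\phi_u(\cdot,x_0)$ denotes the (continuous, piecewise $C^1$) solution with $\phi_u(0,x_0)=x_0$. For $x\in\mathcal{X}$ and $u\in\mathbb{R}^m$ put $v_x(u)=f(x)+\sum_{i=1}^m g_i(x)u_i$. Goodness function. $\mathcal{F}=\bigcup_{T\ge 0}C([0,T],\mathcal{X})$; an element with domain $[0,T]$ is written $\phi|_{[0,T]}$. A function $G:\mathcal{F}\times\mathbb{R}^n\to\mathbb{R}$ has Lipschitz constant $L$ if for all $\phi_1|_{[0,T_1]},\phi_2|_{[0,T_2]}\in\mathcal{F}$ and $v_1,v_2\in\mathbb{R}^n$, $$|G(\phi_1|_{[0,T_1]},v_1)-G(\phi_2|_{[0,T_2]},v_2)|\le L\big(d(\phi_1|_{[0,T_1]},\phi_2|_{[0,T_2]})+\|v_1-v_2\|\big),$$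 where $d(\phi_1|_{[0,T_1]},\phi_2|_{[0,T_2]})=|T_1-T_2|+\max_{t\in[0,\min(T_1,T_2)]}\|\phi_1(t)-\phi_2(t)\|$ ($d$ is not claimed to be a metric). Learn-Control Algorithm with parameters $\varepsilon>0$, $0<\delta\le1$. Initialize $u^*:=0\in\mathbb{R}^m$, $t_0:=0$, with the system in state $x_0$. Repeat forever: (1) Let $x^0$ be the current state of the system (at time $t_0$). (2) Let $\Delta u^0=0$, and for $j=1,\dots,m$ choose $\Delta u^j\in\{\delta e_j,-\delta e_j\}$ ($e_j$ the standard basis vectors) such that $u^*+\Delta u^j\in\mathcal{U}$ (such a choice always exists). (3) For $j=0,\dots,m$ in turn: apply the constant control $u^*+\Delta u^j$ on the time interval $[t_0+j\varepsilon,t_0+(j+1)\varepsilon)$ and let $x^{j+1}$ be the state at the end of this interval. (4) Define $\tilde v:\mathcal{U}\to\mathbb{R}^n$ by $\tilde v(u)=\sum_{j=0}^m\lambda_j (x^{j+1}-x^j)/\varepsilon$, where $\lambda_0,\dots,\lambda_m\in\mathbb{R}$ are the unique coefficients with $\sum_j\lambda_j=1$ and $u=\sum_j\lambda_j(u^*+\Delta u^j)$. (5) Replace $u^*$ by any element of $\operatorname{argmax}_{u\in\mathcal{U}}G(\phi|_{[0,t_0+(m+1)\varepsilon]},\tilde v(u))$, where $\phi|_{[0,t_0+(m+1)\varepsilon]}$ is the system trajectory from time $0$ up to time $t_0+(m+1)\varepsilon$. (6) Replace $t_0$ by $t_0+(m+1)\varepsilon$. *)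

theory Defs
  imports "HOL-Analysis.Analysis"
begin

definition control_set :: "(real ^ 'm) set" where
  "control_set = {u. \<forall>i. \<bar>u $ i\<bar> \<le> 1}"

definition velocity ::
  "(real ^ 'n \<Rightarrow> real ^ 'n) \<Rightarrow> ('m \<Rightarrow> real ^ 'n \<Rightarrow> real ^ 'n) \<Rightarrow> real ^ 'n \<Rightarrow> real ^ 'm \<Rightarrow> real ^ 'n"
where
  "velocity f g x u = f x + (\<Sum>i\<in>UNIV. u $ i *\<^sub>R g i x)"

definition control_affine_system ::
  "(real ^ 'n) set \<Rightarrow> (real ^ 'n \<Rightarrow> real ^ 'n) \<Rightarrow> ('m \<Rightarrow> real ^ 'n \<Rightarrow> real ^ 'n) \<Rightarrow> real \<Rightarrow> real \<Rightarrow> bool"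
where
  "control_affine_system X f g M0 M1 \<longleftrightarrow>
     0 \<le> M0 \<and> 0 \<le> M1 \<and>
     continuous_on X f \<and> (\<forall>i. continuous_on X (g i)) \<and>
     (\<forall>x\<in>X. norm (f x) \<le> M0) \<and>
     (\<forall>i. \<forall>x\<in>X. norm (g i x) \<le> M0) \<and>
     (\<forall>x\<in>X. \<forall>y\<in>X. norm (f x - f y) \<le> M1 * norm (x - y)) \<and>
     (\<forall>i. \<forall>x\<in>X. \<forall>y\<in>X. norm (g i x - g i y) \<le> M1 * norm (x - y))"

text \<open>
  Solution of the system on \<open>[0,\<infinity>)\<close> for a piecewise-constant, right-continuous control law \<open>u\<close>:
  the ODE holds, with one-sided derivatives at the end points, on every interval \<open>[a,b]\<close> such
  that \<open>u\<close> is constant on \<open>[a,b)\<close>. Values of \<open>u\<close> and \<open>\<phi>\<close> at negative times are irrelevant.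
  For control laws that are not piecewise constant this definition is not meaningful.
\<close>

definition is_trajectory ::
  "(real ^ 'n) set \<Rightarrow> (real ^ 'n \<Rightarrow> real ^ 'n) \<Rightarrow> ('m \<Rightarrow> real ^ 'n \<Rightarrow> real ^ 'n) \<Rightarrow>
   real ^ 'n \<Rightarrow> (real \<Rightarrow> real ^ 'm) \<Rightarrow> (real \<Rightarrow> real ^ 'n) \<Rightarrow> bool"
where
  "is_trajectory X f g x0 u \<phi> \<longleftrightarrow>
     \<phi> 0 = x0 \<and> continuous_on {0..} \<phi> \<and> \<phi> ` {0..} \<subseteq> X \<and>
     (\<forall>a b c. 0 \<le> a \<and> a < b \<and> (\<forall>t\<in>{a..<b}. u t = c) \<longrightarrow>
        (\<forall>t\<in>{a..b}. (\<phi> has_vector_derivative velocity f g (\<phi> t) c) (at t within {a..b})))"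

text \<open>
  An element of \<open>C([0,T],X)\<close> is a pair of \<open>T\<close> and a function that is \<open>undefined\<close> outside
  \<open>[0,T]\<close>, so that equality of pairs is equality of functions on \<open>[0,T]\<close>.
\<close>

type_synonym 'n path_segment = "real \<times> (real \<Rightarrow> real ^ 'n)"

definition path_segments :: "(real ^ 'n) set \<Rightarrow> 'n path_segment set" where
  "path_segments X =
     {(T, p). 0 \<le> T \<and> continuous_on {0..T} p \<and> p \<in> {0..T} \<rightarrow>\<^sub>E X}"

definition segment :: "(real \<Rightarrow> real ^ 'n) \<Rightarrow> real \<Rightarrow> 'n path_segment" where
  "segment \<phi> T = (T, restrict \<phi> {0..T})"

text \<open>
  On \<open>path_segments X\<close> the supremum is that of a continuous function on a nonempty compact
  interval, hence a maximum.
\<close>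

definition segment_dist :: "'n::finite path_segment \<Rightarrow> 'n path_segment \<Rightarrow> real" where
  "segment_dist P Q =
     \<bar>fst P - fst Q\<bar> + (SUP t\<in>{0..min (fst P) (fst Q)}. norm (snd P t - snd Q t))"

definition goodness_lipschitz ::
  "(real ^ 'n) set \<Rightarrow> real \<Rightarrow> ('n path_segment \<Rightarrow> real ^ 'n \<Rightarrow> real) \<Rightarrow> bool"
where
  "goodness_lipschitz X L G \<longleftrightarrow>
     (\<forall>P\<in>path_segments X. \<forall>Q\<in>path_segments X. \<forall>v w.
        \<bar>G P v - G Q w\<bar> \<le> L * (segment_dist P Q + norm (v - w)))"

text \<open>
  Affine coordinates of \<open>w\<close> with respect to the points \<open>p 0, \<dots>, p m\<close>, where \<open>m = CARD('m)\<close>;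
  coefficients beyond \<open>m\<close> are set to \<open>0\<close> to make the choice unique as a function on \<open>nat\<close>.
\<close>

definition affine_coeffs :: "(nat \<Rightarrow> real ^ 'm) \<Rightarrow> real ^ 'm \<Rightarrow> nat \<Rightarrow> real" where
  "affine_coeffs p w =
     (THE l. (\<forall>j>CARD('m). l j = 0) \<and> (\<Sum>j\<le>CARD('m). l j) = 1 \<and>
             w = (\<Sum>j\<le>CARD('m). l j *\<^sub>R p j))"

definition tilde_v ::
  "real \<Rightarrow> (nat \<Rightarrow> real ^ 'm) \<Rightarrow> (nat \<Rightarrow> real ^ 'n) \<Rightarrow> real ^ 'm \<Rightarrow> real ^ 'n"
where
  "tilde_v \<epsilon> p xs w =
     (\<Sum>j\<le>CARD('m). affine_coeffs p w j *\<^sub>R ((xs (Suc j) - xs j) /\<^sub>R \<epsilon>))"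

text \<open>
  An infinite run of the algorithm. Iteration \<open>k\<close> starts at time \<open>t0 k\<close> with \<open>u\<^sup>* = us k\<close> and
  uses the perturbations \<open>du k 0, \<dots>, du k m\<close>; \<open>idx 1, \<dots>, idx m\<close> is the order in which the
  control directions are tried. \<open>u\<close> is the control law applied and \<open>\<phi>\<close> the trajectory.
\<close>

definition learn_control_run ::
  "(real ^ 'n) set \<Rightarrow> (real ^ 'n \<Rightarrow> real ^ 'n) \<Rightarrow> ('m::finite \<Rightarrow> real ^ 'n \<Rightarrow> real ^ 'n) \<Rightarrow>
   ('n path_segment \<Rightarrow> real ^ 'n \<Rightarrow> real) \<Rightarrow> (nat \<Rightarrow> 'm) \<Rightarrow> real \<Rightarrow> real \<Rightarrow> real ^ 'n \<Rightarrow>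
   (nat \<Rightarrow> real) \<Rightarrow> (nat \<Rightarrow> real ^ 'm) \<Rightarrow> (nat \<Rightarrow> nat \<Rightarrow> real ^ 'm) \<Rightarrow>
   (real \<Rightarrow> real ^ 'm) \<Rightarrow> (real \<Rightarrow> real ^ 'n) \<Rightarrow> bool"
where
  "learn_control_run X f g G idx \<epsilon> \<delta> x0 t0 us du u \<phi> \<longleftrightarrow>
     is_trajectory X f g x0 u \<phi> \<and>
     t0 0 = 0 \<and> us 0 = 0 \<and>
     (\<forall>k. du k 0 = 0 \<and>
          (\<forall>j\<in>{1..CARD('m)}. du k j \<in> {\<delta> *\<^sub>R axis (idx j) 1, - (\<delta> *\<^sub>R axis (idx j) 1)} \<and>
                             us k + du k j \<in> control_set) \<and>
          (\<forall>j\<le>CARD('m). \<forall>t\<in>{t0 k + real j * \<epsilon> ..< t0 k + (real j + 1) * \<epsilon>}.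
                             u t = us k + du k j) \<and>
          is_arg_max
            (\<lambda>w. G (segment \<phi> (t0 k + (real CARD('m) + 1) * \<epsilon>))
                   (tilde_v \<epsilon> (\<lambda>j. us k + du k j) (\<lambda>j. \<phi> (t0 k + real j * \<epsilon>)) w))
            (\<lambda>w. w \<in> control_set) (us (Suc k)) \<and>
          t0 (Suc k) = t0 k + (real CARD('m) + 1) * \<epsilon>)"

end

theory Submission
  imports Defs
begin

text \<open>
  Two comparisons carry the proof. The difference quotients of one iteration are averages of the
  velocities along the trajectory, so by the speed bound \<open>(m + 1) M0\<close> they agree up to order
  \<open>\<epsilon>\<close> with the velocities at the current state, even during the following iteration. Apart from
  the weight of \<open>u\<^sup>*\<close> itself, the affine coefficients of a control are its coordinates relative to
  \<open>u\<^sup>*\<close> divided by \<open>\<plusminus>\<delta>\<close>; hence their absolute values sum to at most \<open>1 + 4 m / \<delta>\<close> and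
  the error of \<open>tilde_v\<close> is uniformly small. As \<open>G\<close> is Lipschitz, the maximizer of the
  approximate goodness is nearly optimal for the true one, and the exploratory perturbation of size
  \<open>\<delta>\<close> costs a further \<open>L M0 \<delta>\<close>.
\<close>

section \<open>Bounds and affine structure of the velocity field\<close>

lemma norm_velocity_le:
  fixes g :: "'m::finite \<Rightarrow> real ^ 'n \<Rightarrow> real ^ 'n"
  assumes "control_affine_system X f g M0 M1" "x \<in> X" "u \<in> control_set"
  shows "norm (velocity f g x u) \<le> (real CARD('m) + 1) * M0"
proof -
  have M0: "0 \<le> M0" and f: "norm (f x) \<le> M0" and g: "\<And>i. norm (g i x) \<le> M0"
    using assms(1,2) by (auto simp: control_affine_system_def)
  have "norm (\<Sum>i\<in>UNIV. u $ i *\<^sub>R g i x) \<le> (\<Sum>i\<in>(UNIV::'m set). M0)"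
  proof (rule sum_norm_le)
    fix i
    have "\<bar>u $ i\<bar> * norm (g i x) \<le> 1 * M0"
      using assms(3) g[of i] by (intro mult_mono) (auto simp: control_set_def)
    then show "norm (u $ i *\<^sub>R g i x) \<le> M0" by simp
  qed
  then have "norm (velocity f g x u) \<le> M0 + real CARD('m) * M0"
    unfolding velocity_def using f by (intro norm_triangle_le) simp
  then show ?thesis by (simp add: algebra_simps)
qed

lemma norm_velocity_diff_le:
  fixes g :: "'m::finite \<Rightarrow> real ^ 'n \<Rightarrow> real ^ 'n"
  assumes "control_affine_system X f g M0 M1" "x \<in> X" "y \<in> X" "u \<in> control_set"
  shows "norm (velocity f g x u - velocity f g y u) \<le> (real CARD('m) + 1) * M1 * norm (x - y)"
proof -
  have f: "norm (f x - f y) \<le> M1 * norm (x - y)"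
    and g: "\<And>i. norm (g i x - g i y) \<le> M1 * norm (x - y)"
    using assms(1-3) by (auto simp: control_affine_system_def)
  have "norm (\<Sum>i\<in>UNIV. u $ i *\<^sub>R (g i x - g i y)) \<le> (\<Sum>i\<in>(UNIV::'m set). M1 * norm (x - y))"
  proof (rule sum_norm_le)
    fix i
    have "\<bar>u $ i\<bar> * norm (g i x - g i y) \<le> 1 * (M1 * norm (x - y))"
      using assms(4) g[of i] by (intro mult_mono) (auto simp: control_set_def)
    then show "norm (u $ i *\<^sub>R (g i x - g i y)) \<le> M1 * norm (x - y)" by simp
  qed
  then have bound: "norm ((f x - f y) + (\<Sum>i\<in>UNIV. u $ i *\<^sub>R (g i x - g i y)))
      \<le> M1 * norm (x - y) + real CARD('m) * (M1 * norm (x - y))"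
    using f by (intro norm_triangle_le) simp
  have eq: "velocity f g x u - velocity f g y u
      = (f x - f y) + (\<Sum>i\<in>UNIV. u $ i *\<^sub>R (g i x - g i y))"
    by (simp add: velocity_def scaleR_diff_right sum_subtractf)
  show ?thesis
    unfolding eq by (rule order_trans[OF bound]) (simp add: algebra_simps)
qed

text \<open>Changing one coordinate of the control involves a single field \<open>g i\<close>, so no
  factor \<open>CARD('m)\<close> appears. This prices the exploratory perturbation.\<close>

lemma norm_velocity_add_axis_le:
  assumes "control_affine_system X f g M0 M1" "x \<in> X"
  shows "norm (velocity f g x (u + c *\<^sub>R axis i 1) - velocity f g x u) \<le> M0 * \<bar>c\<bar>"
proof -
  have "(\<Sum>j\<in>UNIV. (c *\<^sub>R axis i (1::real)) $ j *\<^sub>R g j x)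
      = (\<Sum>j\<in>UNIV. if j = i then c *\<^sub>R g i x else 0)"
    by (intro sum.cong) (auto simp: axis_def)
  then have "velocity f g x (u + c *\<^sub>R axis i 1) - velocity f g x u = c *\<^sub>R g i x"
    by (simp add: velocity_def scaleR_add_left sum.distrib)
  then show ?thesis
    using assms mult_left_mono[of "norm (g i x)" M0 "\<bar>c\<bar>"]
    by (simp add: control_affine_system_def mult.commute)
qed

text \<open>The control part is linear, and the drift \<open>f x\<close> survives because the
  weights sum to one. Hence \<open>tilde_v\<close> and the true velocity at a fixed state can be
  compared term by term with the same weights.\<close>

lemma velocity_affine_combination:
  assumes "(\<Sum>j\<in>J. c j) = 1"
  shows "velocity f g x (\<Sum>j\<in>J. c j *\<^sub>R p j) = (\<Sum>j\<in>J. c j *\<^sub>R velocity f g x (p j))"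
proof -
  have "(\<Sum>i\<in>UNIV. (\<Sum>j\<in>J. c j *\<^sub>R p j) $ i *\<^sub>R g i x)
      = (\<Sum>j\<in>J. c j *\<^sub>R (\<Sum>i\<in>UNIV. p j $ i *\<^sub>R g i x))"
    by (simp add: scaleR_sum_left scaleR_sum_right sum.swap[of _ J])
  moreover have "(\<Sum>j\<in>J. c j *\<^sub>R f x) = f x"
    using assms by (simp flip: scaleR_sum_left)
  ultimately show ?thesis
    by (simp add: velocity_def scaleR_add_right sum.distrib)
qed

lemma continuous_on_velocity: "continuous_on S (velocity f g x)"
  unfolding velocity_def by (intro continuous_intros)

section \<open>The control cube and affine coordinates of its points\<close>

lemma compact_control_set: "compact (control_set :: (real ^ 'm::finite) set)"
proof -
  have "control_set = cbox (-1) (1 :: real ^ 'm)"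
    by (auto simp: control_set_def mem_box_cart abs_le_iff minus_le_iff)
  then show ?thesis by (metis compact_cbox)
qed

text \<open>Relative to \<open>a\<close>, the test controls are signed multiples of distinct basis
  vectors. Each coordinate of \<open>w - a\<close> therefore fixes one weight, and normalisation
  fixes the weight of \<open>a\<close>. This existence and uniqueness give the definite description
  in \<open>affine_coeffs\<close> its meaning.\<close>

lemma affine_coeffs_perturbed:
  fixes a w :: "real ^ 'm::finite" and d :: "nat \<Rightarrow> real ^ 'm"
  assumes idx: "bij_betw idx {1..CARD('m)} UNIV"
    and "\<delta> > 0" and d0: "d 0 = 0"
    and d: "\<forall>j\<in>{1..CARD('m)}. d j \<in> {\<delta> *\<^sub>R axis (idx j) 1, - (\<delta> *\<^sub>R axis (idx j) 1)}"
  defines "c \<equiv> affine_coeffs (\<lambda>j. a + d j) w"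
  shows "(\<Sum>j\<le>CARD('m). c j) = 1"
    and "w = (\<Sum>j\<le>CARD('m). c j *\<^sub>R (a + d j))"
    and "\<And>j. j \<in> {1..CARD('m)} \<Longrightarrow> \<bar>c j\<bar> = \<bar>(w - a) $ idx j\<bar> / \<delta>"
proof -
  \<comment> \<open>The signed step length, equal to plus or minus \<open>\<delta>\<close>; dividing
    by it treats both choices of sign at once.\<close>
  define s where "s j = d j $ idx j" for j
  have ds: "d j = s j *\<^sub>R axis (idx j) 1" and s: "\<bar>s j\<bar> = \<delta>" if "j \<in> {1..CARD('m)}" for j
    using bspec[OF d that] \<open>\<delta> > 0\<close> by (auto simp: s_def)
  have split: "(\<Sum>j\<le>CARD('m). h j) = h 0 + (\<Sum>j\<in>{1..CARD('m)}. h j)" for h :: "nat \<Rightarrow> 'z::comm_monoid_add"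
    by (simp add: atMost_atLeast0 sum.atLeast_Suc_atMost)
  have coord: "(\<Sum>j\<in>{1..CARD('m)}. l j *\<^sub>R d j) $ idx i = l i * s i"
    if "i \<in> {1..CARD('m)}" for i and l :: "nat \<Rightarrow> real"
  proof -
    have "(\<Sum>j\<in>{1..CARD('m)}. l j *\<^sub>R d j) $ idx i = (\<Sum>j\<in>{1..CARD('m)}. if j = i then l i * s i else 0)"
      unfolding sum_component
    proof (rule sum.cong)
      fix j assume j: "j \<in> {1..CARD('m)}"
      have "idx j = idx i \<longleftrightarrow> j = i"
        using inj_on_eq_iff[OF bij_betw_imp_inj_on[OF idx] j that] .
      then show "(l j *\<^sub>R d j) $ idx i = (if j = i then l i * s i else 0)"
        unfolding ds[OF j] by (auto simp: axis_def)
    qed simp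
    then show ?thesis using that by simp
  qed
  \<comment> \<open>Surjectivity of \<open>idx\<close> lets a vector equation be checked coordinate
    by coordinate in the order of the tests.\<close>
  have all_idx: "(\<forall>i. Q i) \<longleftrightarrow> (\<forall>j\<in>{1..CARD('m)}. Q (idx j))" for Q
  proof -
    have "(\<forall>i\<in>idx ` {1..CARD('m)}. Q i) \<longleftrightarrow> (\<forall>j\<in>{1..CARD('m)}. Q (idx j))"
      by blast
    then show ?thesis
      unfolding bij_betw_imp_surj_on[OF idx] by simp
  qed
  have iff: "w = (\<Sum>j\<le>CARD('m). l j *\<^sub>R (a + d j)) \<longleftrightarrow>
      (\<forall>j\<in>{1..CARD('m)}. l j = (w - a) $ idx j / s j)"
    if "(\<Sum>j\<le>CARD('m). l j) = 1" for l :: "nat \<Rightarrow> real"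
  proof -
    have "(\<Sum>j\<le>CARD('m). l j *\<^sub>R (a + d j))
        = (\<Sum>j\<le>CARD('m). l j) *\<^sub>R a + (\<Sum>j\<le>CARD('m). l j *\<^sub>R d j)"
      by (simp add: scaleR_add_right sum.distrib scaleR_sum_left)
    also have "\<dots> = a + (\<Sum>j\<in>{1..CARD('m)}. l j *\<^sub>R d j)"
      using that by (simp add: split d0)
    finally have "w = (\<Sum>j\<le>CARD('m). l j *\<^sub>R (a + d j)) \<longleftrightarrow>
        w - a = (\<Sum>j\<in>{1..CARD('m)}. l j *\<^sub>R d j)"
      by (auto simp: algebra_simps)
    also have "\<dots> \<longleftrightarrow> (\<forall>i. (w - a) $ i = (\<Sum>j\<in>{1..CARD('m)}. l j *\<^sub>R d j) $ i)"
      by (simp only: vec_eq_iff)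
    also have "\<dots> \<longleftrightarrow> (\<forall>j\<in>{1..CARD('m)}. (w - a) $ idx j = (\<Sum>i\<in>{1..CARD('m)}. l i *\<^sub>R d i) $ idx j)"
      by (rule all_idx)
    also have "\<dots> \<longleftrightarrow> (\<forall>j\<in>{1..CARD('m)}. (w - a) $ idx j = l j * s j)"
      by (simp only: coord cong: ball_cong)
    also have "\<dots> \<longleftrightarrow> (\<forall>j\<in>{1..CARD('m)}. l j = (w - a) $ idx j / s j)"
      using s \<open>\<delta> > 0\<close> by (intro ball_cong refl) (force simp: field_simps)
    finally show ?thesis .
  qed
  define P where "P l \<longleftrightarrow> (\<forall>j>CARD('m). l j = 0) \<and> (\<Sum>j\<le>CARD('m). l j) = 1 \<and>
    w = (\<Sum>j\<le>CARD('m). l j *\<^sub>R (a + d j))" for l :: "nat \<Rightarrow> real"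
  define r where "r j = (w - a) $ idx j / s j" for j
  \<comment> \<open>Index 0 carries the unperturbed control and takes the remaining weight; the
    value 0 beyond \<open>CARD('m)\<close> matches the convention of
    \<open>affine_coeffs\<close>.\<close>
  define l where "l j = (if j = 0 then 1 - (\<Sum>j\<in>{1..CARD('m)}. r j)
    else if j \<le> CARD('m) then r j else 0)" for j
  have "(\<Sum>j\<le>CARD('m). l j) = 1"
    by (simp add: split l_def)
  then have "P l"
    unfolding P_def using iff[of l] by (simp add: l_def r_def)
  moreover have "l' = l" if "P l'" for l'
  proof
    have eq: "l' j = r j" if "j \<in> {1..CARD('m)}" for j
      using \<open>P l'\<close> iff[of l'] that by (auto simp: P_def r_def)
    have "l' 0 = 1 - (\<Sum>j\<in>{1..CARD('m)}. l' j)"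
      using \<open>P l'\<close> by (simp add: P_def split)
    then show "l' j = l j" for j
      using \<open>P l'\<close> eq by (simp add: l_def P_def)
  qed
  ultimately have "P (THE l. P l)"
    by (rule theI)
  moreover have "c = (THE l. P l)"
    by (simp add: c_def affine_coeffs_def P_def)
  ultimately have "P c" by simp
  then show 1: "(\<Sum>j\<le>CARD('m). c j) = 1" and 2: "w = (\<Sum>j\<le>CARD('m). c j *\<^sub>R (a + d j))"
    unfolding P_def by blast+
  show "\<bar>c j\<bar> = \<bar>(w - a) $ idx j\<bar> / \<delta>" if "j \<in> {1..CARD('m)}" for j
    using iff[OF 1] 2 s[OF that] that by (simp add: abs_divide)
qed

text \<open>Coordinates of two points of the cube differ by at most 2, so each perturbed control has
  weight at most \<open>2 / \<delta>\<close> in absolute value. The weight at index 0 is one minus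
  their sum, which doubles this contribution and adds 1.\<close>

lemma sum_abs_affine_coeffs_le:
  fixes a w :: "real ^ 'm::finite" and d :: "nat \<Rightarrow> real ^ 'm"
  assumes idx: "bij_betw idx {1..CARD('m)} UNIV"
    and "\<delta> > 0" and "d 0 = 0"
    and "\<forall>j\<in>{1..CARD('m)}. d j \<in> {\<delta> *\<^sub>R axis (idx j) 1, - (\<delta> *\<^sub>R axis (idx j) 1)}"
    and aw: "a \<in> control_set" "w \<in> control_set"
  shows "(\<Sum>j\<le>CARD('m). \<bar>affine_coeffs (\<lambda>j. a + d j) w j\<bar>) \<le> 1 + 4 * real CARD('m) / \<delta>"
proof -
  define c where "c = affine_coeffs (\<lambda>j. a + d j) w"
  note c = affine_coeffs_perturbed[where a=a and w=w and d=d, OF assms(1-4), folded c_def]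
  have split: "(\<Sum>j\<le>CARD('m). h j) = h 0 + (\<Sum>j\<in>{1..CARD('m)}. h j)" for h :: "nat \<Rightarrow> real"
    by (simp add: atMost_atLeast0 sum.atLeast_Suc_atMost)
  have "(\<Sum>j\<in>{1..CARD('m)}. \<bar>c j\<bar>) \<le> (\<Sum>j\<in>{1..CARD('m)}. 2 / \<delta>)"
  proof (rule sum_mono)
    fix j assume j: "j \<in> {1..CARD('m)}"
    have "\<bar>w $ idx j\<bar> \<le> 1" "\<bar>a $ idx j\<bar> \<le> 1"
      using aw by (auto simp: control_set_def)
    then have "\<bar>(w - a) $ idx j\<bar> \<le> 2" by simp
    then show "\<bar>c j\<bar> \<le> 2 / \<delta>"
      using c(3)[OF j] \<open>\<delta> > 0\<close> by (simp add: divide_right_mono)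
  qed
  moreover have "\<bar>c 0\<bar> \<le> 1 + (\<Sum>j\<in>{1..CARD('m)}. \<bar>c j\<bar>)"
    using c(1) sum_abs[of c "{1..CARD('m)}"] unfolding split by linarith
  moreover have "4 * real CARD('m) / \<delta> = 2 * (\<Sum>j\<in>{1..CARD('m)}. 2 / \<delta>)"
    by simp
  ultimately show ?thesis
    unfolding split c_def[symmetric] by linarith
qed

section \<open>Difference quotients and the speed of trajectories\<close>

lemma onorm_scaleR_left_le:
  fixes v :: "'a::real_normed_vector"
  assumes "norm v \<le> B"
  shows "onorm (\<lambda>h::real. h *\<^sub>R v) \<le> B"
  using assms by (intro onorm_le) (simp add: mult.commute[of B] mult_left_mono)

text \<open>Subtracting the linear motion with velocity \<open>v\<close> leaves a curve whose
  derivative is \<open>D s - v\<close>; the mean value inequality for that curve, divided by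
  \<open>b - a\<close>, is the claim.\<close>

lemma norm_difference_quotient_diff_le:
  fixes \<phi> :: "real \<Rightarrow> 'a::real_normed_vector"
  assumes "a < b"
    and D: "\<And>s. s \<in> {a..b} \<Longrightarrow> (\<phi> has_vector_derivative D s) (at s within {a..b})"
    and B: "\<And>s. s \<in> {a..b} \<Longrightarrow> norm (D s - v) \<le> B"
  shows "norm ((\<phi> b - \<phi> a) /\<^sub>R (b - a) - v) \<le> B"
proof -
  define \<psi> where "\<psi> s = \<phi> s - s *\<^sub>R v" for s
  have "(\<psi> has_derivative (\<lambda>h. h *\<^sub>R (D s - v))) (at s within {a..b})" if "s \<in> {a..b}" for s
    using D[OF that] unfolding \<psi>_def has_vector_derivative_def
    by (auto intro!: derivative_eq_intros simp: algebra_simps)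
  then have "norm (\<psi> b - \<psi> a) \<le> B * norm (b - a)"
    using \<open>a < b\<close> B
    by (intro differentiable_bound[of "{a..b}" \<psi> "\<lambda>s h. h *\<^sub>R (D s - v)"])
      (auto intro!: onorm_scaleR_left_le)
  moreover have "\<psi> b - \<psi> a = (b - a) *\<^sub>R ((\<phi> b - \<phi> a) /\<^sub>R (b - a) - v)"
    using \<open>a < b\<close> by (simp add: \<psi>_def scaleR_diff_right scaleR_diff_left)
  ultimately show ?thesis
    using \<open>a < b\<close> by simp
qed

text \<open>The derivative may jump when the control switches. The speed bound is therefore applied
  on each closed cell of length \<open>\<epsilon>\<close>, with one-sided derivatives at its ends,
  and the cells are glued together.\<close>

lemma trajectory_lipschitz_on:
  fixes g :: "'m::finite \<Rightarrow> real ^ 'n \<Rightarrow> real ^ 'n"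
  assumes sys: "control_affine_system X f g M0 M1" and traj: "is_trajectory X f g x0 u \<phi>"
    and "\<epsilon> > 0"
    and u: "\<And>n::nat. \<exists>c\<in>control_set. \<forall>s\<in>{real n * \<epsilon>..<(real n + 1) * \<epsilon>}. u s = c"
  shows "((real CARD('m) + 1) * M0)-lipschitz_on {0..} \<phi>"
proof -
  have M0: "0 \<le> M0" using sys by (simp add: control_affine_system_def)
  have X: "\<phi> s \<in> X" if "0 \<le> s" for s
    using traj that by (auto simp: is_trajectory_def)
  have piece: "((real CARD('m) + 1) * M0)-lipschitz_on {real n * \<epsilon>..(real n + 1) * \<epsilon>} \<phi>" for n
  proof -
    obtain c where c: "c \<in> control_set" "\<forall>s\<in>{real n * \<epsilon>..<(real n + 1) * \<epsilon>}. u s = c"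
      using u by blast
    have "(\<phi> has_vector_derivative velocity f g (\<phi> s) c)
        (at s within {real n * \<epsilon>..(real n + 1) * \<epsilon>})" if "s \<in> {real n * \<epsilon>..(real n + 1) * \<epsilon>}" for s
      using traj c(2) that \<open>\<epsilon> > 0\<close> by (auto simp: is_trajectory_def)
    moreover have "norm (velocity f g (\<phi> s) c) \<le> (real CARD('m) + 1) * M0"
      if "s \<in> {real n * \<epsilon>..(real n + 1) * \<epsilon>}" for s
    proof (rule norm_velocity_le[OF sys X c(1)])
      have "0 \<le> real n * \<epsilon>" using \<open>\<epsilon> > 0\<close> by simp
      then show "0 \<le> s" using that by (meson atLeastAtMost_iff order_trans)
    qed
    ultimately show ?thesis
      using M0
      by (intro bounded_derivative_imp_lipschitz[where f'="\<lambda>s h. h *\<^sub>R velocity f g (\<phi> s) c"])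
        (auto intro!: onorm_scaleR_left_le simp: has_vector_derivative_def)
  qed
  have upto: "((real CARD('m) + 1) * M0)-lipschitz_on {0..real n * \<epsilon>} \<phi>" for n
  proof (induction n)
    case 0
    show ?case using M0 by (simp add: lipschitz_on_def)
  next
    case (Suc n)
    \<comment> \<open>The conditional with equal branches gives \<open>\<phi>\<close> the shape
      expected by the gluing rule \<open>lipschitz_on_concat\<close>.\<close>
    have "((real CARD('m) + 1) * M0)-lipschitz_on {0..(real n + 1) * \<epsilon>}
        (\<lambda>s. if s \<le> real n * \<epsilon> then \<phi> s else \<phi> s)"
      by (rule lipschitz_on_concat[OF Suc piece]) simp
    then show ?case by (simp add: add.commute)
  qed
  show ?thesis
  proof (rule lipschitz_onI)
    fix r s :: real assume "r \<in> {0..}" "s \<in> {0..}"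
    moreover obtain n :: nat where "max r s / \<epsilon> \<le> real n"
      using real_arch_simple by blast
    ultimately have "r \<in> {0..real n * \<epsilon>}" "s \<in> {0..real n * \<epsilon>}"
      using \<open>\<epsilon> > 0\<close> by (auto simp: field_simps)
    then show "dist (\<phi> r) (\<phi> s) \<le> (real CARD('m) + 1) * M0 * dist r s"
      by (rule lipschitz_onD[OF upto])
  qed (use M0 in simp)
qed

section \<open>Path segments, the goodness function and approximate maximizers\<close>

lemma segment_in_path_segments:
  assumes "continuous_on {0..} \<phi>" "\<phi> ` {0..} \<subseteq> X" "0 \<le> T"
  shows "segment \<phi> T \<in> path_segments X"
proof -
  have "continuous_on {0..T} \<phi>"
    using assms(1) by (rule continuous_on_subset) auto
  then have "continuous_on {0..T} (restrict \<phi> {0..T})"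
    by (rule continuous_on_eq) simp
  then show ?thesis
    using assms(2,3) by (auto simp: segment_def path_segments_def)
qed

text \<open>Both segments come from one trajectory and agree on the common interval, so the supremum
  vanishes. A delay thus affects the goodness only through its length.\<close>

lemma segment_dist_segment:
  assumes "0 \<le> S" "0 \<le> T"
  shows "segment_dist (segment \<phi> S) (segment \<phi> T) = \<bar>S - T\<bar>"
proof -
  have "(SUP t\<in>{0..min S T}. norm (restrict \<phi> {0..S} t - restrict \<phi> {0..T} t))
      = (SUP t\<in>{0..min S T}. 0)"
    by (rule SUP_cong) auto
  then show ?thesis
    using assms by (simp add: segment_dist_def segment_def)
qed

text \<open>The sign of \<open>L\<close> is not assumed. It follows by comparing two velocities at
  positive distance on the same segment.\<close>

lemma goodness_lipschitz_nonneg: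
  fixes G :: "'n::finite path_segment \<Rightarrow> real ^ 'n \<Rightarrow> real"
  assumes "goodness_lipschitz X L G" "P \<in> path_segments X" "segment_dist P P = 0"
  shows "0 \<le> L"
proof -
  have "0 \<le> \<bar>G P 1 - G P 0\<bar>" by simp
  also have "\<dots> \<le> L * norm (1 :: real ^ 'n)"
    using assms unfolding goodness_lipschitz_def by (metis add_0 diff_zero)
  finally show ?thesis
    by (simp add: zero_le_mult_iff)
qed

text \<open>Passing from \<open>k\<close> to \<open>h\<close> at \<open>y\<close> and back at
  \<open>x\<close> costs \<open>\<eta>\<close> each time, while \<open>h y \<le> h x\<close>; hence
  the factor 2.\<close>

lemma is_arg_max_near_optimal:
  fixes h k :: "'a \<Rightarrow> real"
  assumes h: "is_arg_max h P x" and k: "is_arg_max k P y"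
    and close: "\<And>w. P w \<Longrightarrow> \<bar>h w - k w\<bar> \<le> \<eta>"
  shows "\<bar>k x - k y\<bar> \<le> 2 * \<eta>"
proof -
  have "P x" "P y" "h y \<le> h x" "k x \<le> k y"
    using h k by (auto simp: is_arg_max_linorder)
  then show ?thesis
    using close[of x] close[of y] by linarith
qed

theorem theorem18:
  fixes X :: "(real ^ 'n) set"
    and f :: "real ^ 'n \<Rightarrow> real ^ 'n"
    and g :: "'m::finite \<Rightarrow> real ^ 'n \<Rightarrow> real ^ 'n"
    and G :: "'n path_segment \<Rightarrow> real ^ 'n \<Rightarrow> real"
    and idx :: "nat \<Rightarrow> 'm"
    and M0 M1 L \<epsilon> \<delta> t :: real
    and x0 :: "real ^ 'n"
    and t0 :: "nat \<Rightarrow> real"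
    and us :: "nat \<Rightarrow> real ^ 'm"
    and du :: "nat \<Rightarrow> nat \<Rightarrow> real ^ 'm"
    and u :: "real \<Rightarrow> real ^ 'm"
    and \<phi> :: "real \<Rightarrow> real ^ 'n"
  assumes "control_affine_system X f g M0 M1"
    and "bij_betw idx {1..CARD('m)} UNIV"
    and "x0 \<in> X" and "\<epsilon> > 0" and "0 < \<delta>" and "\<delta> \<le> 1"
    and "goodness_lipschitz X L G"
    and "learn_control_run X f g G idx \<epsilon> \<delta> x0 t0 us du u \<phi>"
    and "t \<ge> (real CARD('m) + 1) * \<epsilon>"
  shows "\<exists>umax. is_arg_max (\<lambda>w. G (segment \<phi> t) (velocity f g (\<phi> t) w))
                           (\<lambda>w. w \<in> control_set) umax \<and>
           \<bar>G (segment \<phi> t) (velocity f g (\<phi> t) (u t))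
             - G (segment \<phi> t) (velocity f g (\<phi> t) umax)\<bar>
           \<le> 6 * L * (M0 + 1) * (M1 + 1) * (real CARD('m) + 1) ^ 3
               * (1 + 4 * real CARD('m) * sqrt (real CARD('m)) / \<delta>) * \<epsilon>
             + L * M0 * (real CARD('m) + 1) * \<delta>"
proof -

  \<comment> \<open>Unpacking the run: times, controls and segments\<close>
  define N where "N = real CARD('m) + 1"
  define p where "p k j = us k + du k j" for k j
  have pk: "p k = (\<lambda>j. us k + du k j)" for k
    by (simp add: p_def fun_eq_iff)
  have N: "N \<ge> 1" by (simp add: N_def)
  have M: "0 \<le> M0" "0 \<le> M1"
    using assms(1) by (auto simp: control_affine_system_def)
  have traj: "is_trajectory X f g x0 u \<phi>"
    using assms(8) by (simp add: learn_control_run_def)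
  then have X: "\<phi> s \<in> X" if "0 \<le> s" for s
    using that by (auto simp: is_trajectory_def)
  have seg: "segment \<phi> s \<in> path_segments X" if "0 \<le> s" for s
    using traj that by (auto simp: is_trajectory_def intro!: segment_in_path_segments)
  have L: "0 \<le> L"
    using goodness_lipschitz_nonneg[OF assms(7) seg[of 0]] by (simp add: segment_dist_segment)
  have du0: "du k 0 = 0" for k
    using assms(8) by (simp add: learn_control_run_def)
  have du: "du k j \<in> {\<delta> *\<^sub>R axis (idx j) 1, - (\<delta> *\<^sub>R axis (idx j) 1)}" "p k j \<in> control_set"
    if "j \<in> {1..CARD('m)}" for k j
    using assms(8) that unfolding learn_control_run_def p_def by blast+
  have du_ball: "\<forall>j\<in>{1..CARD('m)}. du k j \<in> {\<delta> *\<^sub>R axis (idx j) 1, - (\<delta> *\<^sub>R axis (idx j) 1)}" for k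
    using du(1) by blast
  have t0: "t0 k = real k * N * \<epsilon>" for k
    using assms(8) by (induction k) (auto simp: learn_control_run_def N_def algebra_simps)
  have amax: "is_arg_max
      (\<lambda>w. G (segment \<phi> (t0 (Suc k))) (tilde_v \<epsilon> (p k) (\<lambda>j. \<phi> (t0 k + real j * \<epsilon>)) w))
      (\<lambda>w. w \<in> control_set) (us (Suc k))" for k
    using assms(8) by (simp add: learn_control_run_def pk)
  have us: "us k \<in> control_set" for k
  proof (cases k)
    case 0
    then show ?thesis using assms(8) by (simp add: learn_control_run_def control_set_def)
  next
    case (Suc i)
    then show ?thesis using amax[of i] by (simp add: is_arg_max_def)
  qed
  have p: "p k j \<in> control_set" if "j \<le> CARD('m)" for k j
    using that du(2)[of j k] us[of k] by (cases "j = 0") (auto simp: p_def du0)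
  have u: "u s = p k j" if "j \<le> CARD('m)" "s \<in> {t0 k + real j * \<epsilon>..<t0 k + (real j + 1) * \<epsilon>}" for k j s
    using assms(8) that by (simp add: learn_control_run_def p_def)
  have div_mod: "real n = real (n div (CARD('m) + 1)) * N + real (n mod (CARD('m) + 1))" for n
    using arg_cong[OF div_mult_mod_eq[of n "CARD('m) + 1"], of real]
    by (simp only: of_nat_add of_nat_mult of_nat_1 N_def)
  \<comment> \<open>On the grid of mesh \<open>\<epsilon>\<close>, the quotient of the cell number
    by \<open>CARD('m) + 1\<close> is the iteration and the remainder is the test within it.\<close>
  have un: "u s = p (n div (CARD('m) + 1)) (n mod (CARD('m) + 1))"
    if "s \<in> {real n * \<epsilon>..<(real n + 1) * \<epsilon>}" for n s
  proof (rule u)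
    have "n mod (CARD('m) + 1) < CARD('m) + 1"
      by simp
    then show "n mod (CARD('m) + 1) \<le> CARD('m)"
      by linarith
    show "s \<in> {t0 (n div (CARD('m) + 1)) + real (n mod (CARD('m) + 1)) * \<epsilon>
        ..<t0 (n div (CARD('m) + 1)) + (real (n mod (CARD('m) + 1)) + 1) * \<epsilon>}"
      using that unfolding t0 div_mod[of n] by (simp add: algebra_simps)
  qed
  have lip: "(N * M0)-lipschitz_on {0..} \<phi>"
    unfolding N_def
  proof (rule trajectory_lipschitz_on[OF assms(1) traj \<open>\<epsilon> > 0\<close>])
    fix n :: nat
    have "n mod (CARD('m) + 1) \<le> CARD('m)"
      using mod_less_divisor[of "CARD('m) + 1" n] by linarith
    then show "\<exists>c\<in>control_set. \<forall>s\<in>{real n * \<epsilon>..<(real n + 1) * \<epsilon>}. u s = c"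
      using un p by blast
  qed

  \<comment> \<open>Locating the current time in the iteration following a completed one\<close>
  define n where "n = nat \<lfloor>t / \<epsilon>\<rfloor>"
  have t_pos: "0 \<le> t"
    using assms(9) N \<open>\<epsilon> > 0\<close> unfolding N_def[symmetric] by (smt (verit) mult_pos_pos)
  have "real n \<le> t / \<epsilon>" "t / \<epsilon> < real n + 1"
    using t_pos \<open>\<epsilon> > 0\<close> by (auto simp: n_def of_nat_nat)
  then have tn: "t \<in> {real n * \<epsilon>..<(real n + 1) * \<epsilon>}"
    using \<open>\<epsilon> > 0\<close> by (simp add: field_simps)
  have "t < (real n + 1) * \<epsilon>"
    using tn by simp
  \<comment> \<open>The right end of the cell is excluded, so the inequality is strict and
    integrality gives \<open>CARD('m) + 1 \<le> n\<close>. The current iteration is then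
    \<open>Suc k\<close>, and its base control was chosen from the data of iteration
    \<open>k\<close>.\<close>
  with assms(9) have "N * \<epsilon> < (real n + 1) * \<epsilon>"
    unfolding N_def by (rule le_less_trans)
  then have "N < real n + 1"
    using \<open>\<epsilon> > 0\<close> by (simp only: mult_less_cancel_right_pos)
  then have "CARD('m) + 1 \<le> n"
    unfolding N_def by linarith
  then obtain k where k: "n div (CARD('m) + 1) = Suc k"
    by (metis Suc_eq_plus1 div_greater_zero_iff gr0_implies_Suc zero_less_Suc)
  define j0 where "j0 = n mod (CARD('m) + 1)"
  have j0: "j0 \<le> CARD('m)"
    using mod_less_divisor[of "CARD('m) + 1" n] unfolding j0_def by linarith
  have ut: "u t = p (Suc k) j0"
    using un[OF tn] k j0_def by simp
  have "real n = real (Suc k) * N + real j0"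
    using div_mod[of n] unfolding j0_def k .
  then have "t0 (Suc k) + real j0 * \<epsilon> \<le> t" "t < t0 (Suc k) + (real j0 + 1) * \<epsilon>"
    using tn by (auto simp: t0 algebra_simps)
  moreover have "0 \<le> real j0 * \<epsilon>" "(real j0 + 1) * \<epsilon> \<le> N * \<epsilon>"
    using j0 \<open>\<epsilon> > 0\<close> by (auto simp: N_def)
  ultimately have t: "t0 (Suc k) \<le> t" "t \<le> t0 (Suc k) + N * \<epsilon>"
    by linarith+
  have t0k: "0 \<le> t0 k" "t0 (Suc k) = t0 k + N * \<epsilon>" "0 \<le> t0 (Suc k)"
    using N \<open>\<epsilon> > 0\<close> by (simp_all add: t0 algebra_simps)

  \<comment> \<open>Error of the learned velocities\<close>
  define B where "B = N * M1 * (N * M0 * (2 * N * \<epsilon>))"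
  have B: "0 \<le> B" using N M \<open>\<epsilon> > 0\<close> by (simp add: B_def)
  have quot: "norm ((\<phi> (t0 k + real (Suc j) * \<epsilon>) - \<phi> (t0 k + real j * \<epsilon>)) /\<^sub>R \<epsilon>
      - velocity f g (\<phi> t) (p k j)) \<le> B" if j: "j \<le> CARD('m)" for j
  proof -
    define a where "a = t0 k + real j * \<epsilon>"
    define b where "b = t0 k + real (Suc j) * \<epsilon>"
    have "0 \<le> real j * \<epsilon>" "real (Suc j) * \<epsilon> \<le> N * \<epsilon>"
      using j \<open>\<epsilon> > 0\<close> by (auto simp: N_def)
    then have ab: "t0 k \<le> a" "b \<le> t0 (Suc k)" "b - a = \<epsilon>"
      by (auto simp: a_def b_def t0k algebra_simps)
    have "\<forall>s\<in>{a..<b}. u s = p k j"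
      using u[OF j] by (simp add: a_def b_def add.commute)
    then have D: "(\<phi> has_vector_derivative velocity f g (\<phi> s) (p k j)) (at s within {a..b})"
      if "s \<in> {a..b}" for s
      using traj that ab t0k \<open>\<epsilon> > 0\<close> by (auto simp: is_trajectory_def)
    have "norm (velocity f g (\<phi> s) (p k j) - velocity f g (\<phi> t) (p k j)) \<le> B"
      if "s \<in> {a..b}" for s
    proof -
      \<comment> \<open>The measurement lies in iteration \<open>k\<close> and \<open>t\<close> in
        the next one, so two iteration lengths separate them at most. The speed bound
        \<open>N * M0\<close> and the Lipschitz constant \<open>N * M1\<close> of the velocity
        supply the other factors of \<open>B\<close>.\<close>
      have s: "0 \<le> s" "\<bar>s - t\<bar> \<le> 2 * N * \<epsilon>"
        using that ab t0k t by auto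
      have "norm (\<phi> s - \<phi> t) \<le> N * M0 * \<bar>s - t\<bar>"
        using lipschitz_onD[OF lip, of s t] s t_pos by (simp add: dist_norm)
      also have "\<dots> \<le> N * M0 * (2 * N * \<epsilon>)"
        using s N M by (intro mult_left_mono) auto
      finally have "N * M1 * norm (\<phi> s - \<phi> t) \<le> B"
        unfolding B_def using N M by (intro mult_left_mono) auto
      then show ?thesis
        using norm_velocity_diff_le[OF assms(1) X[OF s(1)] X[OF t_pos] p[OF j, of k]]
        by (simp add: N_def)
    qed
    then have "norm ((\<phi> b - \<phi> a) /\<^sub>R (b - a) - velocity f g (\<phi> t) (p k j)) \<le> B"
      using D ab \<open>\<epsilon> > 0\<close> by (intro norm_difference_quotient_diff_le) auto
    then show ?thesis by (simp add: ab(3)) (simp add: a_def b_def)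
  qed

  define A where "A = 1 + 4 * real CARD('m) / \<delta>"
  define vt where "vt = tilde_v \<epsilon> (p k) (\<lambda>j. \<phi> (t0 k + real j * \<epsilon>))"
  have vt: "norm (vt w - velocity f g (\<phi> t) w) \<le> A * B" if w: "w \<in> control_set" for w
  proof -
    define c where "c = affine_coeffs (p k) w"
    define q where "q j = (\<phi> (t0 k + real (Suc j) * \<epsilon>) - \<phi> (t0 k + real j * \<epsilon>)) /\<^sub>R \<epsilon>" for j
    note c = affine_coeffs_perturbed(1,2)[where a="us k" and w=w and d="du k",
        OF assms(2,5) du0 du_ball, folded pk, folded c_def p_def]
    have "velocity f g (\<phi> t) w = (\<Sum>j\<le>CARD('m). c j *\<^sub>R velocity f g (\<phi> t) (p k j))"
      using velocity_affine_combination[OF c(1), of f g "\<phi> t" "p k"] c(2) by simp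
    then have "vt w - velocity f g (\<phi> t) w
        = (\<Sum>j\<le>CARD('m). c j *\<^sub>R (q j - velocity f g (\<phi> t) (p k j)))"
      by (simp add: vt_def tilde_v_def c_def q_def scaleR_diff_right sum_subtractf)
    also have "norm \<dots> \<le> (\<Sum>j\<le>CARD('m). \<bar>c j\<bar> * B)"
      using quot by (intro sum_norm_le) (auto simp: q_def intro!: mult_left_mono)
    also have "\<dots> = (\<Sum>j\<le>CARD('m). \<bar>c j\<bar>) * B"
      by (simp add: sum_distrib_right)
    also have "\<dots> \<le> A * B"
      using sum_abs_affine_coeffs_le[where a="us k" and w=w and d="du k",
          OF assms(2,5) du0 du_ball us w] B
      unfolding c_def pk A_def by (intro mult_right_mono)
    finally show ?thesis .
  qed

  \<comment> \<open>Near-optimality of the base control\<close>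
  have G: "\<bar>G (segment \<phi> s) v - G (segment \<phi> t) w\<bar> \<le> L * (\<bar>s - t\<bar> + norm (v - w))"
    if "0 \<le> s" for s v w
    using assms(7) seg[OF that] seg[OF t_pos] segment_dist_segment[OF that t_pos, of \<phi>]
    unfolding goodness_lipschitz_def by metis
  define H where "H w = G (segment \<phi> t) (velocity f g (\<phi> t) w)" for w
  \<comment> \<open>The algorithm maximized on the segment ending at \<open>t0 (Suc k)\<close>;
    \<open>N * \<epsilon>\<close> pays for the time elapsed since then and \<open>A * B\<close> for
    the velocity error.\<close>
  have close: "\<bar>G (segment \<phi> (t0 (Suc k))) (vt w) - H w\<bar> \<le> L * (N * \<epsilon> + A * B)"
    if "w \<in> control_set" for w
  proof -
    have "L * (\<bar>t0 (Suc k) - t\<bar> + norm (vt w - velocity f g (\<phi> t) w)) \<le> L * (N * \<epsilon> + A * B)"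
      using vt[OF that] t L by (intro mult_left_mono add_mono) auto
    then show ?thesis
      unfolding H_def using G[OF t0k(3)] by (meson order_trans)
  qed
  have "continuous_on UNIV (G (segment \<phi> t))"
  proof -
    have "L-lipschitz_on UNIV (G (segment \<phi> t))"
      using G[OF t_pos] L by (intro lipschitz_onI) (auto simp: dist_norm)
    then show ?thesis by (rule lipschitz_on_continuous_on)
  qed
  then have "continuous_on control_set H"
    unfolding H_def
    by (rule continuous_on_compose2[OF _ continuous_on_velocity]) simp
  moreover have "control_set \<noteq> ({} :: (real ^ 'm) set)"
    using us by blast
  ultimately obtain umax where "umax \<in> control_set" "\<forall>w\<in>control_set. H w \<le> H umax"
    using continuous_attains_sup[OF compact_control_set] by blast
  then have umax: "is_arg_max H (\<lambda>w. w \<in> control_set) umax"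
    by (simp add: is_arg_max_linorder)
  have opt: "\<bar>H (us (Suc k)) - H umax\<bar> \<le> 2 * (L * (N * \<epsilon> + A * B))"
    using is_arg_max_near_optimal[OF amax[of k, folded vt_def] umax close] .

  \<comment> \<open>Cost of the exploratory perturbation\<close>
  have "\<exists>c i. u t = us (Suc k) + c *\<^sub>R axis i 1 \<and> \<bar>c\<bar> \<le> \<delta>"
  proof (cases "j0 = 0")
    case True
    \<comment> \<open>The unperturbed test is covered by a zero coefficient, for which any axis will
      do.\<close>
    then have "u t = us (Suc k) + 0 *\<^sub>R axis (idx 0) 1"
      by (simp add: ut p_def du0)
    then show ?thesis using \<open>0 < \<delta>\<close> by (metis abs_zero less_imp_le)
  next
    case False
    then have "du (Suc k) j0 \<in> {\<delta> *\<^sub>R axis (idx j0) 1, (- \<delta>) *\<^sub>R axis (idx j0) 1}"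
      using du(1)[of j0 "Suc k"] j0 by auto
    then show ?thesis
      unfolding ut p_def using \<open>0 < \<delta>\<close>
      by (metis abs_minus_cancel abs_of_pos insert_iff order_refl singletonD)
  qed
  then obtain c i where ci: "u t = us (Suc k) + c *\<^sub>R axis i 1" "\<bar>c\<bar> \<le> \<delta>"
    by blast
  have "norm (velocity f g (\<phi> t) (u t) - velocity f g (\<phi> t) (us (Suc k))) \<le> M0 * \<delta>"
    unfolding ci(1)
    using norm_velocity_add_axis_le[OF assms(1) X[OF t_pos]] ci(2) M
    by (meson mult_left_mono order_trans)
  then have "L * (\<bar>t - t\<bar> + norm (velocity f g (\<phi> t) (u t) - velocity f g (\<phi> t) (us (Suc k))))
      \<le> L * (M0 * \<delta>)"
    using L by (intro mult_left_mono) auto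
  then have "\<bar>H (u t) - H (us (Suc k))\<bar> \<le> L * (M0 * \<delta>)"
    unfolding H_def using G[OF t_pos] by (meson order_trans)
  then have total: "\<bar>H (u t) - H umax\<bar> \<le> 2 * (L * (N * \<epsilon> + A * B)) + L * (M0 * \<delta>)"
    using opt by linarith

  \<comment> \<open>Collecting the constants\<close>
  define C where "C = 1 + 4 * real CARD('m) * sqrt (real CARD('m)) / \<delta>"
  define W where "W = N ^ 3 * C"
  have "real CARD('m) \<ge> 1" by simp
  \<comment> \<open>The coefficient sum needs no square root; the stated constant is larger because
    \<open>sqrt (real CARD('m))\<close> is at least 1.\<close>
  then have "4 * real CARD('m) * 1 \<le> 4 * real CARD('m) * sqrt (real CARD('m))"
    by (intro mult_left_mono) auto
  then have AC: "A \<le> C"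
    using \<open>0 < \<delta>\<close> by (simp add: A_def C_def divide_right_mono)
  have A1: "1 \<le> A" using \<open>0 < \<delta>\<close> by (simp add: A_def)
  \<comment> \<open>This lets the elapsed time and the velocity error share the factor
    \<open>W * \<epsilon>\<close>.\<close>
  have NW: "N \<le> W"
  proof -
    have "N * 1 \<le> N ^ 3 * C"
      using N A1 AC by (intro mult_mono) (auto simp: power_increasing[of 1 3 N, simplified])
    then show ?thesis by (simp add: W_def)
  qed
  have "A * B = 2 * (M0 * M1) * (N ^ 3 * A) * \<epsilon>"
    by (simp add: B_def power3_eq_cube)
  also have "\<dots> \<le> 2 * (M0 * M1) * W * \<epsilon>"
    unfolding W_def using AC N M \<open>\<epsilon> > 0\<close> by (intro mult_right_mono mult_left_mono) auto
  finally have AB: "A * B \<le> 2 * (M0 * M1) * W * \<epsilon>" .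
  have "N * \<epsilon> + A * B \<le> W * \<epsilon> + 2 * (M0 * M1) * W * \<epsilon>"
    using AB NW \<open>\<epsilon> > 0\<close> by (intro add_mono) auto
  also have "\<dots> = (1 + 2 * (M0 * M1)) * (W * \<epsilon>)"
    by (simp add: algebra_simps)
  \<comment> \<open>A crude bound whose factor 3, times the 2 from near-optimality, yields the 6 of
    the claim.\<close>
  also have "\<dots> \<le> (3 * ((M0 + 1) * (M1 + 1))) * (W * \<epsilon>)"
    using M NW N \<open>\<epsilon> > 0\<close> by (intro mult_right_mono) (auto simp: algebra_simps)
  finally have "2 * (L * (N * \<epsilon> + A * B)) \<le> 2 * (L * (3 * ((M0 + 1) * (M1 + 1)) * (W * \<epsilon>)))"
    using L by (intro mult_left_mono) auto
  moreover have "2 * (L * (3 * ((M0 + 1) * (M1 + 1)) * (W * \<epsilon>)))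
      = 6 * L * (M0 + 1) * (M1 + 1) * N ^ 3 * C * \<epsilon>"
    by (simp add: W_def algebra_simps)
  moreover have "L * (M0 * \<delta>) * N = L * M0 * N * \<delta>"
    by simp
  \<comment> \<open>The perturbation argument gives \<open>L * M0 * \<delta>\<close>; the claim
    allows the further factor \<open>N\<close>, which is at least 1.\<close>
  moreover have "L * (M0 * \<delta>) \<le> L * (M0 * \<delta>) * N"
    using mult_left_mono[OF N, of "L * (M0 * \<delta>)"] L M \<open>0 < \<delta>\<close> by simp
  ultimately have "\<bar>H (u t) - H umax\<bar>
      \<le> 6 * L * (M0 + 1) * (M1 + 1) * N ^ 3 * C * \<epsilon> + L * M0 * N * \<delta>"
    using total by linarith
  then show ?thesis
    using umax unfolding H_def N_def C_def by blast
qed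

end
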